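(* Let $H\subset\mathbb{R}^2$ be a honeycomb lattice whose unit hexagons have side length $a>0$, let $P$ be the center of a unit hexagon of $H$, and let $u\in\mathbb{R}^2$ be a unit vector whose direction makes an angle of $15^\circ$ with a side of that hexagon. Let $S$ be the scaling along $u$ with factor $7-4\sqrt{3}$ and drag center $P$. Then $S(H)$ is again a honeycomb lattice, its unit hexagons have side length $(2-\sqrt{3})\,a$, and $P$ is the center of a unit hexagon of $S(H)$.
   Context: A honeycomb lattice with side length $a$ is the set of all vertices of a tiling of the plane by regular hexagons of side length $a$ (the unit hexagons). Equivalently, it is an equilateral triangular lattice of side $a$ from which the points of an equilateral triangular sublattice of side $\sqrt3\,a$ (the hexagon centers) have been removed. An angle between a direction and a side means the (acute, unoriented) angle between the corresponding lines. The (directional) scaling along a unit vector $u$ with factor $\gamma>0$ and drag center $P$ is the affine map $S(x)=x+(\gamma-1)\langle x-P,u\rangle u$. *)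

theory Defs
  imports "HOL-Analysis.Analysis"
begin

text \<open>
  The vertices are listed counterclockwise, equally spaced on a circle about the center;
  \<open>p\<close> has period 6, so its range consists of the six vertices.
\<close>
definition regular_hexagon :: "real \<Rightarrow> real^2 \<Rightarrow> (real^2) set \<Rightarrow> bool" where
  "regular_hexagon a c K \<longleftrightarrow>
     (\<exists>(p :: nat \<Rightarrow> real^2) r \<theta>.
        r > 0 \<and>
        (\<forall>k. p k = c + r *\<^sub>R vector [cos (\<theta> + real k * pi / 3), sin (\<theta> + real k * pi / 3)]) \<and>
        (\<forall>k. dist (p k) (p (Suc k)) = a) \<and>
        K = convex hull (range p))"

definition hexagonal_tiling :: "real \<Rightarrow> (real^2) set set \<Rightarrow> bool" where
  "hexagonal_tiling a T \<longleftrightarrow>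
     (\<forall>K\<in>T. \<exists>c. regular_hexagon a c K) \<and>
     \<Union>T = UNIV \<and>
     pairwise (\<lambda>K L. interior K \<inter> interior L = {}) T"

definition tiling_vertices :: "(real^2) set set \<Rightarrow> (real^2) set" where
  "tiling_vertices T = {x. \<exists>K\<in>T. x extreme_point_of K}"

definition honeycomb_lattice :: "real \<Rightarrow> (real^2) set \<Rightarrow> bool" where
  "honeycomb_lattice a H \<longleftrightarrow> (\<exists>T. hexagonal_tiling a T \<and> H = tiling_vertices T)"

definition unit_hexagon :: "real \<Rightarrow> (real^2) set \<Rightarrow> (real^2) set \<Rightarrow> bool" where
  "unit_hexagon a H K \<longleftrightarrow> (\<exists>T. hexagonal_tiling a T \<and> H = tiling_vertices T \<and> K \<in> T)"

text \<open>The acute unoriented angle between the lines spanned by two nonzero vectors.\<close>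
definition line_angle :: "real^2 \<Rightarrow> real^2 \<Rightarrow> real" where
  "line_angle v w = arccos (\<bar>v \<bullet> w\<bar> / (norm v * norm w))"

definition directional_scaling :: "real^2 \<Rightarrow> real \<Rightarrow> real^2 \<Rightarrow> real^2 \<Rightarrow> real^2" where
  "directional_scaling u \<gamma> P x = x + ((\<gamma> - 1) * ((x - P) \<bullet> u)) *\<^sub>R u"

end

theory Submission
  imports Defs
begin

text \<open>
  The centers of the hexagons of a tiling have mutual distances at least \<open>sqrt 3 * a\<close>, since the
  inscribed discs do not overlap, and every point of the plane is within \<open>a\<close> of a center, since
  the circumscribed discs cover. Such a set is a triangular lattice: a point within \<open>a\<close> of
  three centers is the center of an equilateral triangle formed by them, and this forces each
  neighbor of a center to occur together with its rotations by 60 degrees about that center. So the tiling is the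
  standard one, and the honeycomb lattice is the set of \<open>P + m e + n e'\<close> with \<open>m \<noteq> n\<close> modulo 3,
  where \<open>e\<close> is parallel to the given side and \<open>e'\<close> is its rotation by 60 degrees. If \<open>f\<close> is the
  image of \<open>e\<close> under the linear part of the scaling, then the image of \<open>e' \<plusminus> 3 e\<close> is the rotation of
  \<open>f\<close> by 60 degrees, so the image of the lattice has the same form.
\<close>

section \<open>Regular hexagons\<close>

definition quarter_turn :: "real^2 \<Rightarrow> real^2" where
  "quarter_turn x = vector [- x $ 2, x $ 1]"

definition rot60 :: "real^2 \<Rightarrow> real^2" where
  "rot60 x = (1/2) *\<^sub>R x + (sqrt 3 / 2) *\<^sub>R quarter_turn x"

text \<open>The orbit of \<open>e\<close> under \<open>rot60\<close>, in counterclockwise order;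
  \<open>rot60\<close> satisfies z^2 = z - 1, so each power is an integer combination of the first
  two.\<close>

definition star :: "real^2 \<Rightarrow> (real^2) set" where
  "star e = {e, rot60 e, rot60 e - e, - e, - rot60 e, e - rot60 e}"

text \<open>A center and one vertex vector replace angle and circumradius; which of the six vertices
  serves as \<open>e\<close> is immaterial.\<close>

definition hexagon :: "real^2 \<Rightarrow> real^2 \<Rightarrow> (real^2) set" where
  "hexagon c e = convex hull ((+) c ` star e)"

text \<open>Centers and vertices together form the full triangular lattice. A step along any element
  of \<open>star e\<close> changes \<open>m - n\<close> by a non-multiple of 3, so the residue
  modulo 3 tells them apart.\<close>

definition hex_centers :: "real^2 \<Rightarrow> real^2 \<Rightarrow> (real^2) set" where
  "hex_centers P e = {P + of_int m *\<^sub>R e + of_int n *\<^sub>R rot60 e | m n :: int. 3 dvd m - n}"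

definition hex_vertices :: "real^2 \<Rightarrow> real^2 \<Rightarrow> (real^2) set" where
  "hex_vertices P e = {P + of_int m *\<^sub>R e + of_int n *\<^sub>R rot60 e | m n :: int. \<not> 3 dvd m - n}"

section \<open>Algebra of the rotation by 60 degrees\<close>

lemma quarter_turn_nth [simp]: "quarter_turn x $ 1 = - x $ 2" "quarter_turn x $ 2 = x $ 1"
  by (simp_all add: quarter_turn_def)

lemma inner_real2: "x \<bullet> y = x $ 1 * y $ 1 + x $ 2 * y $ 2" for x y :: "real^2"
  by (simp add: inner_vec_def sum_2)

lemma vec2_eq_iff: "x = y \<longleftrightarrow> x $ 1 = y $ 1 \<and> x $ 2 = y $ 2" for x y :: "real^2"
  by (simp add: vec_eq_iff forall_2)

lemma rot60_nth: "rot60 x $ 1 = x $ 1 / 2 - sqrt 3 / 2 * x $ 2" "rot60 x $ 2 = x $ 2 / 2 + sqrt 3 / 2 * x $ 1"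
  by (simp_all add: rot60_def)

lemma rot60_add: "rot60 (x + y) = rot60 x + rot60 y"
  and rot60_diff: "rot60 (x - y) = rot60 x - rot60 y"
  and rot60_minus: "rot60 (- x) = - rot60 x"
  and rot60_scale: "rot60 (s *\<^sub>R x) = s *\<^sub>R rot60 x"
  by (simp_all add: vec2_eq_iff rot60_nth field_simps)

lemma rot60_rot60: "rot60 (rot60 x) = rot60 x - x"
  by (simp add: vec2_eq_iff rot60_nth field_simps)

lemma inner_rot60: "rot60 x \<bullet> rot60 y = x \<bullet> y"
  by (simp add: inner_real2 rot60_nth field_simps)

lemma inner_rot60_self: "x \<bullet> rot60 x = (x \<bullet> x) / 2" "rot60 x \<bullet> x = (x \<bullet> x) / 2"
  by (simp_all add: inner_real2 rot60_nth field_simps)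

lemma norm_rot60 [simp]: "norm (rot60 x) = norm x"
  by (simp add: norm_eq_sqrt_inner inner_rot60)

text \<open>Since \<open>e \<bullet> rot60 e\<close> is half of \<open>e \<bullet> e\<close>,
  lengths are given by the Eisenstein form, to which the lattice estimates reduce.\<close>

lemma norm_comb: "(norm (\<alpha> *\<^sub>R e + \<beta> *\<^sub>R rot60 e))\<^sup>2 = (\<alpha>\<^sup>2 + \<alpha> * \<beta> + \<beta>\<^sup>2) * (norm e)\<^sup>2"
  by (simp add: power2_norm_eq_inner inner_rot60 inner_rot60_self inner_add_left inner_add_right,
      simp add: power2_eq_square field_simps)

lemmas rot60_simps = rot60_add rot60_diff rot60_minus rot60_scale rot60_rot60

lemma star_self: "e \<in> star e" by (simp add: star_def)

lemma star_rot60: "star (rot60 e) = star e"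
  by (auto simp: star_def rot60_simps)

lemma star_minus: "star (- e) = star e"
  by (auto simp: star_def rot60_simps)

text \<open>Orbits of a cyclic group: each element generates the same one. Any vertex or side vector
  can thus replace \<open>e\<close>.\<close>

lemma star_eq: assumes "v \<in> star e" shows "star v = star e"
proof -
  have "star (rot60 (rot60 e)) = star e" by (simp only: star_rot60)
  then have 1: "star (rot60 e - e) = star e" by (simp only: rot60_rot60)
  have 2: "star (e - rot60 e) = star e" using star_minus[of "rot60 e - e"] 1 by simp
  have "v = e \<or> v = rot60 e \<or> v = rot60 e - e \<or> v = - e \<or> v = - rot60 e \<or> v = e - rot60 e"
    using assms by (simp add: star_def)
  then show ?thesis using 1 2 by (elim disjE) (simp_all only: star_rot60 star_minus)
qed

lemma star_uminus: "v \<in> star e \<Longrightarrow> - v \<in> star e"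
  using star_eq star_minus star_self by metis

lemma norm_star: assumes "v \<in> star e" shows "norm v = norm e"
proof -
  have "norm (rot60 (rot60 e)) = norm e" by (simp only: norm_rot60)
  then have "norm (rot60 e - e) = norm e" by (simp only: rot60_rot60)
  then show ?thesis using assms unfolding star_def by (auto simp: norm_minus_commute)
qed

section \<open>Hexagons and their vertices\<close>

lemma hexagon_eq: "v \<in> star e \<Longrightarrow> hexagon c v = hexagon c e"
  by (simp add: hexagon_def star_eq)

lemma hexagon_vertex: "v \<in> star e \<Longrightarrow> c + v \<in> hexagon c e"
  unfolding hexagon_def by (simp add: hull_inc)

lemma hexagon_convex: "convex (hexagon c e)"
  by (simp add: hexagon_def)

lemma hexagon_closed: "closed (hexagon c e)"
  unfolding hexagon_def star_def by (intro compact_imp_closed compact_convex_hull finite_imp_compact) simp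

lemma hexagon_subset_cball: "hexagon c e \<subseteq> cball c (norm e)"
  unfolding hexagon_def by (rule hull_minimal) (auto simp: dist_norm norm_star)

lemma convex_combination_center:
  fixes c x y :: "'a :: real_vector"
  assumes "0 \<le> \<alpha>" "0 \<le> \<beta>" "\<alpha> + \<beta> \<le> 1"
   and "convex S" "c \<in> S" "c + x \<in> S" "c + y \<in> S"
  shows "c + \<alpha> *\<^sub>R x + \<beta> *\<^sub>R y \<in> S"
proof -
  have "c + \<alpha> *\<^sub>R x + \<beta> *\<^sub>R y \<in> convex hull {c, c + x, c + y}"
    unfolding convex_hull_3_alt using assms(1-3) by auto
  also have "\<dots> \<subseteq> S" using assms(4-) by (intro hull_minimal) auto
  finally show ?thesis .
qed

lemma center_in_hexagon: "c \<in> hexagon c e"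
proof -
  have "(1/2) *\<^sub>R (c + e) + (1/2) *\<^sub>R (c + - e) \<in> hexagon c e"
    by (intro convexD[OF hexagon_convex] hexagon_vertex star_uminus star_self) auto
  moreover have "(1/2) *\<^sub>R (c + e) + (1/2) *\<^sub>R (c + - e) = c"
    by (simp add: vec2_eq_iff field_simps)
  ultimately show ?thesis by simp
qed

lemma sextant_in_hexagon:
  assumes "0 \<le> \<alpha>" "0 \<le> \<beta>" "\<alpha> + \<beta> \<le> 1" "v \<in> star e"
  shows "c + \<alpha> *\<^sub>R v + \<beta> *\<^sub>R rot60 v \<in> hexagon c e"
proof -
  have "rot60 v \<in> star e"
    using assms(4) star_eq star_rot60 star_self by metis
  with assms show ?thesis
    by (intro convex_combination_center hexagon_convex center_in_hexagon hexagon_vertex)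
qed

text \<open>The vertices lie on the circle bounding a disc that contains the hexagon, and an
  interior point of a segment is strictly closer to the center than one of its ends.\<close>

lemma vertex_extreme:
  assumes "v \<in> star e" shows "(c + v) extreme_point_of (hexagon c e)"
proof -
  have "c + v \<notin> open_segment a b" if "a \<in> hexagon c e" "b \<in> hexagon c e" for a b
  proof
    assume "c + v \<in> open_segment a b"
    then have "dist c (c + v) < dist c a \<or> dist c (c + v) < dist c b"
      by (rule dist_decreases_open_segment)
    then show False
      using that hexagon_subset_cball[of c e] norm_star[OF assms] by (auto simp: dist_norm subset_iff)
  qed
  then show ?thesis
    using hexagon_vertex[OF assms] by (auto simp: extreme_point_of_def)
qed

lemma extreme_hexagon_iff: "x extreme_point_of (hexagon c e) \<longleftrightarrow> x - c \<in> star e"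
proof
  assume "x extreme_point_of (hexagon c e)"
  then have "x \<in> (+) c ` star e" unfolding hexagon_def by (rule extreme_point_of_convex_hull)
  then show "x - c \<in> star e" by auto
next
  assume "x - c \<in> star e" then show "x extreme_point_of (hexagon c e)"
    using vertex_extreme[of "x - c" e c] by simp
qed

text \<open>A point at maximal distance from the center is extreme. This later fixes the orientation
  of a tile from a single point.\<close>

lemma hexagon_dist_imp_vertex:
  assumes "x \<in> hexagon c e" "dist c x = norm e"
  shows "x - c \<in> star e"
proof -
  have "x \<notin> open_segment a b" if "a \<in> hexagon c e" "b \<in> hexagon c e" for a b
  proof
    assume "x \<in> open_segment a b"
    then have "dist c x < dist c a \<or> dist c x < dist c b"
      by (rule dist_decreases_open_segment)
    then show False
      using that hexagon_subset_cball[of c e] assms(2) by (auto simp: subset_iff)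
  qed
  then show ?thesis
    using assms(1) by (auto simp: extreme_point_of_def simp flip: extreme_hexagon_iff)
qed

section \<open>Coordinates with respect to \<open>e\<close> and \<open>rot60 e\<close>\<close>

lemma basis_coords:
  assumes "e \<noteq> 0" obtains \<alpha> \<beta> where "x = \<alpha> *\<^sub>R e + \<beta> *\<^sub>R rot60 e"
proof -
  define n where "n = e $ 1 * e $ 1 + e $ 2 * e $ 2"
  have n: "n \<noteq> 0" using assms unfolding n_def by (metis inner_eq_zero_iff inner_real2)
  define q where "q = x \<bullet> quarter_turn e / n"
  define p where "p = x \<bullet> e / n"
  have 1: "p * e $ 1 - q * e $ 2 = x $ 1" "p * e $ 2 + q * e $ 1 = x $ 2"
    using n unfolding p_def q_def
    by (simp_all add: inner_real2 divide_simps) (simp_all add: n_def algebra_simps)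
  \<comment> \<open>\<open>p\<close> and \<open>q\<close> are coordinates in the orthogonal basis
    \<open>e\<close>, \<open>quarter_turn e\<close>, and \<open>quarter_turn e\<close> equals
    \<open>(2 *\<^sub>R rot60 e - e)\<close> divided by \<open>sqrt 3\<close>.\<close>
  have "x = (p - q / sqrt 3) *\<^sub>R e + (2 * q / sqrt 3) *\<^sub>R rot60 e"
    unfolding vec2_eq_iff by (simp add: rot60_nth 1[symmetric] field_simps)
  then show ?thesis using that by blast
qed

lemma sextant_coords:
  assumes "e \<noteq> 0"
  obtains v \<alpha> \<beta> where "v \<in> star e" "0 \<le> \<alpha>" "0 \<le> \<beta>" "x = \<alpha> *\<^sub>R v + \<beta> *\<^sub>R rot60 v"
proof -
  obtain \<alpha> \<beta> where x: "x = \<alpha> *\<^sub>R e + \<beta> *\<^sub>R rot60 e"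
    using basis_coords[OF assms] by blast
  \<comment> \<open>The signs of \<alpha>, \<beta> and \<alpha> + \<beta> cut the plane into the six
    cones between consecutive vectors of the star.\<close>
  consider "\<alpha> \<ge> 0" "\<beta> \<ge> 0" | "\<alpha> \<le> 0" "\<beta> \<ge> 0" "\<alpha> + \<beta> \<ge> 0" | "\<alpha> \<le> 0" "\<beta> \<ge> 0" "\<alpha> + \<beta> \<le> 0"
    | "\<alpha> \<le> 0" "\<beta> \<le> 0" | "\<alpha> \<ge> 0" "\<beta> \<le> 0" "\<alpha> + \<beta> \<le> 0" | "\<alpha> \<ge> 0" "\<beta> \<le> 0" "\<alpha> + \<beta> \<ge> 0"
    by linarith
  then show ?thesis
  proof cases
    case 1 show ?thesis by (rule that[of e \<alpha> \<beta>]) (use 1 x in \<open>auto simp: star_def\<close>)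
  next
    case 2 show ?thesis by (rule that[of "rot60 e" "\<alpha> + \<beta>" "- \<alpha>"])
        (use 2 x in \<open>auto simp: star_def rot60_simps algebra_simps\<close>)
  next
    case 3 show ?thesis by (rule that[of "rot60 e - e" "\<beta>" "- (\<alpha> + \<beta>)"])
        (use 3 x in \<open>auto simp: star_def rot60_simps algebra_simps\<close>)
  next
    case 4 show ?thesis by (rule that[of "- e" "- \<alpha>" "- \<beta>"])
        (use 4 x in \<open>auto simp: star_def rot60_simps algebra_simps\<close>)
  next
    case 5 show ?thesis by (rule that[of "- rot60 e" "- (\<alpha> + \<beta>)" "\<alpha>"])
        (use 5 x in \<open>auto simp: star_def rot60_simps algebra_simps\<close>)
  next
    case 6 show ?thesis by (rule that[of "e - rot60 e" "- \<beta>" "\<alpha> + \<beta>"])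
        (use 6 x in \<open>auto simp: star_def rot60_simps algebra_simps\<close>)
  qed
qed

text \<open>In a sextant the form \<alpha>^2 + \<alpha>\<beta> + \<beta>^2 is at least 3/4 of
  (\<alpha> + \<beta>)^2, so the inscribed radius bounds \<alpha> + \<beta> by 1.\<close>

lemma ball_subset_hexagon: "ball c (sqrt 3 / 2 * norm e) \<subseteq> hexagon c e"
proof (cases "e = 0")
  case False
  show ?thesis
  proof
    fix y assume y: "y \<in> ball c (sqrt 3 / 2 * norm e)"
    obtain v \<alpha> \<beta> where v: "v \<in> star e" "0 \<le> \<alpha>" "0 \<le> \<beta>" "y - c = \<alpha> *\<^sub>R v + \<beta> *\<^sub>R rot60 v"
      using sextant_coords[OF False] by blast
    have "(norm (y - c))\<^sup>2 \<le> (sqrt 3 / 2 * norm e)\<^sup>2"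
      using y by (intro power_mono) (auto simp: dist_norm norm_minus_commute)
    then have "(\<alpha>\<^sup>2 + \<alpha> * \<beta> + \<beta>\<^sup>2) * (norm e)\<^sup>2 \<le> 3 / 4 * (norm e)\<^sup>2"
      unfolding v(4) norm_comb norm_star[OF v(1)] by (simp add: power_mult_distrib power_divide)
    then have "\<alpha>\<^sup>2 + \<alpha> * \<beta> + \<beta>\<^sup>2 \<le> 3 / 4"
      using False by simp
    moreover have "0 \<le> (\<alpha> - \<beta>)\<^sup>2" by simp
    ultimately have "(\<alpha> + \<beta>)\<^sup>2 \<le> 1\<^sup>2"
      by (simp add: power2_eq_square algebra_simps)
    then have "\<alpha> + \<beta> \<le> 1" by (rule power2_le_imp_le) simp
    then have "c + \<alpha> *\<^sub>R v + \<beta> *\<^sub>R rot60 v \<in> hexagon c e"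
      using v by (intro sextant_in_hexagon) auto
    then show "y \<in> hexagon c e" using v(4) by (simp add: algebra_simps)
  qed
qed auto

lemma ball_subset_interior_hexagon:
  assumes "norm e = a" shows "ball c (sqrt 3 / 2 * a) \<subseteq> interior (hexagon c e)"
  using ball_subset_hexagon[of c e] assms by (intro interior_maximal) auto

text \<open>By the parallelogram law, two opposite points \<open>c + e\<close> and
  \<open>c - e\<close> lie in the disc of radius \<open>norm e\<close> about \<open>c'\<close> only
  if \<open>c'\<close> is their midpoint.\<close>

lemma hexagon_center_unique:
  assumes "hexagon c e = hexagon c' e'" "norm e = norm e'" shows "c = c'"
proof -
  have "c + e \<in> hexagon c e" "c + - e \<in> hexagon c e"
    by (intro hexagon_vertex star_uminus star_self)+
  then have "norm (c + e - c') \<le> norm e" "norm (c - e - c') \<le> norm e"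
    using hexagon_subset_cball[of c' e'] assms by (auto simp: subset_iff dist_norm norm_minus_commute)
  then have "norm ((c - c') + e)^2 \<le> norm e ^2" "norm ((c - c') - e)^2 \<le> norm e ^ 2"
    by (auto simp: algebra_simps)
  then have "(c - c') \<bullet> (c - c') \<le> 0"
    by (simp add: power2_norm_eq_inner inner_add_left inner_add_right inner_diff_left inner_diff_right inner_commute)
  then show ?thesis by (metis inner_gt_zero_iff not_le right_minus_eq)
qed

text \<open>Translates the trigonometric description into orbits of \<open>rot60\<close>, with side
  length equal to circumradius.\<close>

lemma regular_hexagon_iff:
  assumes "a > 0"
  shows "regular_hexagon a c K \<longleftrightarrow> (\<exists>e. norm e = a \<and> K = hexagon c e)"
proof -
  define z :: "real \<Rightarrow> real^2" where "z t = vector [cos t, sin t]" for t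
  have z_rot: "z (t + pi / 3) = rot60 (z t)" for t
    by (simp add: z_def vec2_eq_iff rot60_nth cos_add sin_add cos_60 sin_60)
  have norm_z: "norm (z t) = 1" for t
    by (simp add: z_def norm_eq_sqrt_inner inner_real2 flip: power2_eq_square)
  have step: "z (\<theta> + real (Suc k) * pi / 3) = rot60 (z (\<theta> + real k * pi / 3))" for \<theta> k
    using z_rot[of "\<theta> + real k * pi / 3"] by (simp add: algebra_simps add_divide_distrib)
  have in_star: "z (\<theta> + real k * pi / 3) \<in> star (z \<theta>)" for \<theta> k
  proof (induction k)
    case (Suc k) then show ?case unfolding step by (metis star_eq star_rot60 star_self)
  qed (simp add: star_self)
  have range: "range (\<lambda>k. c + r *\<^sub>R z (\<theta> + real k * pi / 3)) = (+) c ` star (r *\<^sub>R z \<theta>)" for r \<theta>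
  proof
    have "(*\<^sub>R) r ` star (z \<theta>) = star (r *\<^sub>R z \<theta>)"
      by (simp add: star_def rot60_simps scaleR_diff_right)
    then show "range (\<lambda>k. c + r *\<^sub>R z (\<theta> + real k * pi / 3)) \<subseteq> (+) c ` star (r *\<^sub>R z \<theta>)"
      using in_star by blast
    have 0: "z (\<theta> + real 0 * pi / 3) = z \<theta>" by simp
    have 1: "z (\<theta> + real (Suc 0) * pi / 3) = rot60 (z \<theta>)" by (simp only: step 0 rot60_simps)
    have 2: "z (\<theta> + real (Suc (Suc 0)) * pi / 3) = rot60 (z \<theta>) - z \<theta>" by (simp only: step 0 rot60_simps)
    have 3: "z (\<theta> + real (Suc (Suc (Suc 0))) * pi / 3) = - z \<theta>" by (simp only: step 0 rot60_simps) simp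
    have 4: "z (\<theta> + real (Suc (Suc (Suc (Suc 0)))) * pi / 3) = - rot60 (z \<theta>)" by (simp only: step 0 rot60_simps) simp
    have 5: "z (\<theta> + real (Suc (Suc (Suc (Suc (Suc 0))))) * pi / 3) = z \<theta> - rot60 (z \<theta>)" by (simp only: step 0 rot60_simps) simp
    have "star (z \<theta>) \<subseteq> range (\<lambda>k. z (\<theta> + real k * pi / 3))"
      unfolding star_def using 0 1 2 3 4 5 by (metis (no_types, lifting) empty_subsetI insert_subset rangeI)
    then show "(+) c ` star (r *\<^sub>R z \<theta>) \<subseteq> range (\<lambda>k. c + r *\<^sub>R z (\<theta> + real k * pi / 3))"
      unfolding \<open>(*\<^sub>R) r ` star (z \<theta>) = star (r *\<^sub>R z \<theta>)\<close>[symmetric] by blast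
  qed
  have dist: "dist (c + r *\<^sub>R z (\<theta> + real k * pi / 3)) (c + r *\<^sub>R z (\<theta> + real (Suc k) * pi / 3)) = r"
    if "r > 0" for r \<theta> k
  proof -
    define y where "y = z (\<theta> + real k * pi / 3)"
    \<comment> \<open>The side vector is itself a rotation of the vertex vector
      \<open>y\<close>.\<close>
    have "norm (rot60 y - y) = norm y" by (rule norm_star) (simp add: star_def)
    moreover have "norm y = 1" by (simp add: y_def norm_z)
    ultimately show ?thesis
      using that unfolding step y_def[symmetric]
      by (simp add: dist_norm norm_minus_commute flip: scaleR_diff_right)
  qed
  show ?thesis
  proof
    assume "regular_hexagon a c K"
    then obtain p r \<theta> where r: "r > 0" and p: "\<And>k. p k = c + r *\<^sub>R z (\<theta> + real k * pi / 3)"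
      and d: "\<And>k. dist (p k) (p (Suc k)) = a" and K: "K = convex hull (range p)"
      unfolding regular_hexagon_def z_def by blast
    have "a = r" using d[of 0] dist[OF r, of \<theta> 0] by (simp add: p)
    have "p = (\<lambda>k. c + r *\<^sub>R z (\<theta> + real k * pi / 3))" using p by blast
    then have "K = hexagon c (r *\<^sub>R z \<theta>)" unfolding K hexagon_def range[symmetric] by simp
    moreover have "norm (r *\<^sub>R z \<theta>) = a" using r \<open>a = r\<close> by (simp add: norm_z)
    ultimately show "\<exists>e. norm e = a \<and> K = hexagon c e" by blast
  next
    assume "\<exists>e. norm e = a \<and> K = hexagon c e"
    then obtain e where e: "norm e = a" "K = hexagon c e" by blast
    have "(e $ 1 / a)\<^sup>2 + (e $ 2 / a)\<^sup>2 = 1"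
      using e(1) assms by (auto simp: norm_eq_sqrt_inner inner_real2 power_divide simp flip: power2_eq_square add_divide_distrib)
    then obtain t where t: "e $ 1 / a = cos t" "e $ 2 / a = sin t"
      using sincos_total_2pi by blast
    have "e = a *\<^sub>R z t" using t assms by (simp add: vec2_eq_iff z_def field_simps)
    then have K: "K = convex hull (range (\<lambda>k. c + a *\<^sub>R z (t + real k * pi / 3)))"
      unfolding range e(2) hexagon_def by simp
    show "regular_hexagon a c K" unfolding regular_hexagon_def
      by (rule exI[of _ "\<lambda>k. c + a *\<^sub>R z (t + real k * pi / 3)"], rule exI[of _ a], rule exI[of _ t])
        (use assms dist K in \<open>auto simp: z_def\<close>)
  qed
qed

section \<open>The standard hexagonal tiling\<close>

text \<open>Twice the form is a sum of three squares.\<close>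

lemma int_form_pos:
  fixes m n :: int
  assumes "m \<noteq> 0 \<or> n \<noteq> 0" shows "1 \<le> m\<^sup>2 + m * n + n\<^sup>2"
proof -
  have "0 < m\<^sup>2 + n\<^sup>2" using assms by (simp add: sum_power2_gt_zero_iff)
  then have "0 < m\<^sup>2 + n\<^sup>2 + (m + n)\<^sup>2" by (rule add_pos_nonneg) simp
  also have "\<dots> = 2 * (m\<^sup>2 + m * n + n\<^sup>2)"
    by (simp add: power2_eq_square algebra_simps)
  finally show ?thesis by simp
qed

lemma norm_lattice_ge:
  fixes m n :: int
  assumes "m \<noteq> 0 \<or> n \<noteq> 0"
  shows "norm e \<le> norm (of_int m *\<^sub>R e + of_int n *\<^sub>R rot60 e)"
proof (rule power2_le_imp_le)
  have "1 \<le> real_of_int (m\<^sup>2 + m * n + n\<^sup>2)"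
    using int_form_pos[OF assms] by (simp only: of_int_1_le_iff)
  then have "1 * (norm e)\<^sup>2 \<le> real_of_int (m\<^sup>2 + m * n + n\<^sup>2) * (norm e)\<^sup>2"
    by (rule mult_right_mono) simp
  then show "(norm e)\<^sup>2 \<le> (norm (of_int m *\<^sub>R e + of_int n *\<^sub>R rot60 e))\<^sup>2"
    unfolding norm_comb by simp
qed simp

text \<open>Substituting \<open>m = n + 3 * t\<close> turns the form into 3 times the same form at
  \<open>n + t\<close> and \<open>t\<close>: the sublattice of centers is the full lattice scaled by
  \<open>sqrt 3\<close> and rotated.\<close>

lemma norm_sublattice_ge:
  fixes m n :: int
  assumes "m \<noteq> 0 \<or> n \<noteq> 0" "3 dvd m - n"
  shows "3 * (norm e)\<^sup>2 \<le> (norm (of_int m *\<^sub>R e + of_int n *\<^sub>R rot60 e))\<^sup>2"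
proof -
  obtain t where t: "m = n + 3 * t" using assms(2) by (metis add.commute diff_add_cancel dvdE)
  have "m\<^sup>2 + m * n + n\<^sup>2 = 3 * ((n + t)\<^sup>2 + (n + t) * t + t\<^sup>2)"
    unfolding t by (simp add: power2_eq_square algebra_simps)
  moreover have "1 \<le> (n + t)\<^sup>2 + (n + t) * t + t\<^sup>2"
    using assms(1) t by (intro int_form_pos) auto
  ultimately have "3 \<le> m\<^sup>2 + m * n + n\<^sup>2" by presburger
  then have "3 \<le> real_of_int (m\<^sup>2 + m * n + n\<^sup>2)" by (metis of_int_le_iff of_int_numeral)
  then have "3 * (norm e)\<^sup>2 \<le> real_of_int (m\<^sup>2 + m * n + n\<^sup>2) * (norm e)\<^sup>2"
    by (rule mult_right_mono) simp
  then show ?thesis unfolding norm_comb by simp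
qed

lemma lattice_diff:
  fixes m n m' n' :: int
  shows "(P + of_int m *\<^sub>R e + of_int n *\<^sub>R f) - (P + of_int m' *\<^sub>R e + of_int n' *\<^sub>R f)
    = of_int (m - m') *\<^sub>R e + of_int (n - n') *\<^sub>R (f :: 'a :: real_vector)"
  by (simp add: algebra_simps)

lemma hex_centersI:
  fixes m n :: int
  assumes "3 dvd m - n" "c = P + of_int m *\<^sub>R e + of_int n *\<^sub>R rot60 e"
  shows "c \<in> hex_centers P e"
  using assms by (auto simp: hex_centers_def)

lemma base_in_centers: "P \<in> hex_centers P e"
  by (rule hex_centersI[of 0 0]) auto

lemma hex_centers_dist:
  assumes "c \<in> hex_centers P e" "c' \<in> hex_centers P e" "c \<noteq> c'"
  shows "3 * (norm e)\<^sup>2 \<le> (dist c c')\<^sup>2"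
proof -
  obtain m n m' n' :: int where c: "c = P + of_int m *\<^sub>R e + of_int n *\<^sub>R rot60 e" "3 dvd m - n"
    "c' = P + of_int m' *\<^sub>R e + of_int n' *\<^sub>R rot60 e" "3 dvd m' - n'"
    using assms(1,2) unfolding hex_centers_def by blast
  have "3 dvd (m - m') - (n - n')"
    using dvd_diff[OF c(2) c(4)] by (simp add: algebra_simps)
  moreover have "m - m' \<noteq> 0 \<or> n - n' \<noteq> 0" using assms(3) c by auto
  ultimately show ?thesis
    unfolding dist_norm c lattice_diff by (intro norm_sublattice_ge) auto
qed

lemma vertex_center_dist:
  assumes "c \<in> hex_centers P e" "x \<in> hex_vertices P e"
  shows "norm e \<le> dist x c"
proof -
  obtain m n m' n' :: int where c: "x = P + of_int m *\<^sub>R e + of_int n *\<^sub>R rot60 e" "\<not> 3 dvd m - n"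
    "c = P + of_int m' *\<^sub>R e + of_int n' *\<^sub>R rot60 e" "3 dvd m' - n'"
    using assms unfolding hex_centers_def hex_vertices_def by blast
  have "m - m' \<noteq> 0 \<or> n - n' \<noteq> 0" using c by auto
  then show ?thesis
    unfolding dist_norm c lattice_diff by (rule norm_lattice_ge)
qed

lemma center_add_star:
  assumes "c \<in> hex_centers P e" "v \<in> star e"
  shows "c + v \<in> hex_vertices P e"
proof -
  obtain m n :: int where c: "c = P + of_int m *\<^sub>R e + of_int n *\<^sub>R rot60 e" "3 dvd m - n"
    using assms(1) unfolding hex_centers_def by blast
  have *: "c + v \<in> hex_vertices P e" if "v = of_int i *\<^sub>R e + of_int j *\<^sub>R rot60 e" "\<not> 3 dvd i - j" for i j :: int
  proof -
    have "\<not> 3 dvd (m + i) - (n + j)"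
      using that(2) c(2) by presburger
    moreover have "c + v = P + of_int (m + i) *\<^sub>R e + of_int (n + j) *\<^sub>R rot60 e"
      by (simp add: c that algebra_simps)
    ultimately show ?thesis unfolding hex_vertices_def by blast
  qed
  consider "v = e" | "v = rot60 e" | "v = rot60 e - e" | "v = - e" | "v = - rot60 e" | "v = e - rot60 e"
    using assms(2) by (auto simp: star_def)
  then show ?thesis
  proof cases
    case 1 then show ?thesis by (intro *[of 1 0]) auto
  next case 2 then show ?thesis by (intro *[of 0 1]) auto
  next case 3 then show ?thesis by (intro *[of "-1" 1]) auto
  next case 4 then show ?thesis by (intro *[of "-1" 0]) auto
  next case 5 then show ?thesis by (intro *[of 0 "-1"]) auto
  next case 6 then show ?thesis by (intro *[of 1 "-1"]) auto
  qed
qed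

lemma hex_vertex_cases:
  assumes "x \<in> hex_vertices P e"
  obtains c v where "c \<in> hex_centers P e" "v \<in> star e" "x = c + v"
proof -
  obtain m n :: int where x: "x = P + of_int m *\<^sub>R e + of_int n *\<^sub>R rot60 e" "\<not> 3 dvd m - n"
    using assms unfolding hex_vertices_def by blast
  \<comment> \<open>The residue of \<open>m - n\<close> is 1 or 2, so one of the two neighbors along
    \<open>e\<close> is a center.\<close>
  have "3 dvd (m - 1) - n \<or> 3 dvd (m + 1) - n" using x(2) by presburger
  then consider "3 dvd (m - 1) - n" | "3 dvd (m + 1) - n" by blast
  then show ?thesis
  proof cases
    case 1
    then have "P + of_int (m - 1) *\<^sub>R e + of_int n *\<^sub>R rot60 e \<in> hex_centers P e" by (rule hex_centersI) simp
    then show ?thesis by (rule that[OF _ star_self]) (simp add: x algebra_simps)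
  next
    case 2
    then have "P + of_int (m + 1) *\<^sub>R e + of_int n *\<^sub>R rot60 e \<in> hex_centers P e" by (rule hex_centersI) simp
    then show ?thesis by (rule that[OF _ star_uminus[OF star_self]]) (simp add: x algebra_simps)
  qed
qed

text \<open>The plane is the union of the triangles of the triangular lattice, and each of these has
  exactly one corner among the hexagon centers.\<close>
lemma hexagons_cover:
  assumes "e \<noteq> 0"
  obtains c where "c \<in> hex_centers P e" "x \<in> hexagon c e"
proof -
  note found = that
  obtain \<alpha> \<beta> where ab: "x - P = \<alpha> *\<^sub>R e + \<beta> *\<^sub>R rot60 e"
    using basis_coords[OF assms] by blast
  define i j s t where "i = \<lfloor>\<alpha>\<rfloor>" "j = \<lfloor>\<beta>\<rfloor>" "s = frac \<alpha>" "t = frac \<beta>"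
  have st: "0 \<le> s" "s < 1" "0 \<le> t" "t < 1"
    by (simp_all add: i_j_s_t_def frac_lt_1)
  have x: "x = P + (of_int i + s) *\<^sub>R e + (of_int j + t) *\<^sub>R rot60 e"
    using ab by (simp add: i_j_s_t_def frac_def algebra_simps)
  have *: thesis
    if "3 dvd m - n" "v \<in> star e" "0 \<le> p" "0 \<le> q" "p + q \<le> 1"
      "x = P + of_int m *\<^sub>R e + of_int n *\<^sub>R rot60 e + p *\<^sub>R v + q *\<^sub>R rot60 v" for m n :: int and v p q
  proof (rule found)
    show "P + of_int m *\<^sub>R e + of_int n *\<^sub>R rot60 e \<in> hex_centers P e"
      using that(1) by (rule hex_centersI) simp
    show "x \<in> hexagon (P + of_int m *\<^sub>R e + of_int n *\<^sub>R rot60 e) e"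
      unfolding \<open>x = _ + q *\<^sub>R rot60 v\<close> using that(2-5) by (intro sextant_in_hexagon)
  qed
  \<comment> \<open>The corners \<open>(i, j)\<close>, \<open>(i + 1, j)\<close> and
    \<open>(i, j + 1)\<close> of the parallelogram containing \<open>x\<close> have distinct
    residues, and \<open>(i + 1, j + 1)\<close> shares that of \<open>(i, j)\<close>. The sign of
    \<open>s + t - 1\<close> then selects the triangle on one side of the short diagonal.\<close>
  have "3 dvd i - j \<or> 3 dvd (i + 1) - j \<or> 3 dvd i - (j + 1)" by presburger
  then consider "3 dvd i - j" | "3 dvd (i + 1) - j" | "3 dvd i - (j + 1)" by blast
  then show thesis
  proof cases
    case 1
    show thesis
    proof (cases "s + t \<le> 1")
      case True
      then show thesis using 1 st
        by (intro *[of i j e s t]) (auto simp: star_def x algebra_simps)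
    next
      case False
      then show thesis using 1 st
        by (intro *[of "i + 1" "j + 1" "- e" "1 - s" "1 - t"]) (auto simp: star_def x rot60_simps algebra_simps)
    qed
  next
    case 2
    show thesis
    proof (cases "s + t \<le> 1")
      case True
      then show thesis using 2 st
        by (intro *[of "i + 1" j "rot60 e - e" t "1 - s - t"]) (auto simp: star_def x rot60_simps algebra_simps)
    next
      case False
      then show thesis using 2 st
        by (intro *[of "i + 1" j "rot60 e" "s + t - 1" "1 - s"]) (auto simp: star_def x rot60_simps algebra_simps)
    qed
  next
    case 3
    show thesis
    proof (cases "s + t \<le> 1")
      case True
      then show thesis using 3 st
        by (intro *[of i "j + 1" "- rot60 e" "1 - s - t" s]) (auto simp: star_def x rot60_simps algebra_simps)
    next
      case False
      then show thesis using 3 st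
        by (intro *[of i "j + 1" "e - rot60 e" "1 - t" "s + t - 1"]) (auto simp: star_def x rot60_simps algebra_simps)
    qed
  qed
qed

section \<open>Hexagons lie in the Voronoi cells of their centers\<close>

lemma dist_le_iff_halfspace:
  fixes x c d :: "'a :: real_inner"
  shows "dist x c \<le> dist x d \<longleftrightarrow> (2 *\<^sub>R (d - c)) \<bullet> x \<le> d \<bullet> d - c \<bullet> c"
proof -
  have "dist x c \<le> dist x d \<longleftrightarrow> (dist x c)\<^sup>2 \<le> (dist x d)\<^sup>2"
    by (simp add: power2_le_iff_abs_le)
  moreover have "(dist x y)\<^sup>2 = x \<bullet> x - 2 * (y \<bullet> x) + y \<bullet> y" for y
    by (simp add: dist_norm power2_norm_eq_inner inner_diff_left inner_diff_right inner_commute)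
  ultimately show ?thesis by (auto simp: inner_diff_left)
qed

text \<open>By convexity of the halfplane the vertices suffice, and a vertex is at distance
  \<open>norm e\<close> from its own center and no closer to any other.\<close>

lemma hexagon_voronoi:
  assumes "c \<in> hex_centers P e" "d \<in> hex_centers P e"
  shows "hexagon c e \<subseteq> {x. (2 *\<^sub>R (d - c)) \<bullet> x \<le> d \<bullet> d - c \<bullet> c}"
  unfolding hexagon_def
proof (rule hull_minimal)
  show "(+) c ` star e \<subseteq> {x. (2 *\<^sub>R (d - c)) \<bullet> x \<le> d \<bullet> d - c \<bullet> c}"
  proof clarify
    fix v assume v: "v \<in> star e"
    have "norm e \<le> dist (c + v) d"
      using assms v by (intro vertex_center_dist center_add_star)
    then have "dist (c + v) c \<le> dist (c + v) d"
      using norm_star[OF v] by (simp add: dist_norm)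
    then show "(2 *\<^sub>R (d - c)) \<bullet> (c + v) \<le> d \<bullet> d - c \<bullet> c"
      by (simp only: dist_le_iff_halfspace)
  qed
qed (rule convex_halfspace_le)

lemma hexagons_interior_disjoint:
  assumes "c \<in> hex_centers P e" "d \<in> hex_centers P e" "c \<noteq> d"
  shows "interior (hexagon c e) \<inter> interior (hexagon d e) = {}"
proof -
  have "interior (hexagon c e) \<subseteq> {x. (2 *\<^sub>R (d - c)) \<bullet> x < d \<bullet> d - c \<bullet> c}"
    using interior_mono[OF hexagon_voronoi[OF assms(1,2)]] assms(3)
    by (subst (asm) interior_halfspace_le) auto
  moreover have "interior (hexagon d e) \<subseteq> {x. (2 *\<^sub>R (c - d)) \<bullet> x < c \<bullet> c - d \<bullet> d}"
    using interior_mono[OF hexagon_voronoi[OF assms(2,1)]] assms(3)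
    by (subst (asm) interior_halfspace_le) auto
  ultimately show ?thesis
    by (auto simp: inner_diff_left subset_iff) (smt (verit, best) disjoint_iff)
qed

lemma hexagons_tiling:
  assumes "norm e > 0"
  shows "hexagonal_tiling (norm e) ((\<lambda>c. hexagon c e) ` hex_centers P e)"
  unfolding hexagonal_tiling_def
proof (intro conjI ballI)
  fix K assume "K \<in> (\<lambda>c. hexagon c e) ` hex_centers P e"
  then show "\<exists>c. regular_hexagon (norm e) c K"
    using regular_hexagon_iff[OF assms] by blast
next
  show "\<Union> ((\<lambda>c. hexagon c e) ` hex_centers P e) = UNIV"
    using hexagons_cover[of e P] assms by (auto intro: UNIV_eq_I)
next
  show "pairwise (\<lambda>K L. interior K \<inter> interior L = {}) ((\<lambda>c. hexagon c e) ` hex_centers P e)"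
    unfolding pairwise_def using hexagons_interior_disjoint by blast
qed

lemma hexagons_tiling_vertices:
  "tiling_vertices ((\<lambda>c. hexagon c e) ` hex_centers P e) = hex_vertices P e"
proof
  show "tiling_vertices ((\<lambda>c. hexagon c e) ` hex_centers P e) \<subseteq> hex_vertices P e"
  proof
    fix x assume "x \<in> tiling_vertices ((\<lambda>c. hexagon c e) ` hex_centers P e)"
    then obtain c where "c \<in> hex_centers P e" "x - c \<in> star e"
      unfolding tiling_vertices_def by (auto simp: extreme_hexagon_iff)
    then have "c + (x - c) \<in> hex_vertices P e" by (rule center_add_star)
    then show "x \<in> hex_vertices P e" by simp
  qed
  show "hex_vertices P e \<subseteq> tiling_vertices ((\<lambda>c. hexagon c e) ` hex_centers P e)"
  proof
    fix x assume "x \<in> hex_vertices P e"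
    then obtain c v where "c \<in> hex_centers P e" "v \<in> star e" "x = c + v" by (rule hex_vertex_cases)
    then show "x \<in> tiling_vertices ((\<lambda>c. hexagon c e) ` hex_centers P e)"
      unfolding tiling_vertices_def by (auto simp: extreme_hexagon_iff intro!: bexI[of _ c])
  qed
qed

section \<open>Rigidity of hexagonal tilings\<close>

text \<open>What remains of a tiling when orientations are forgotten: disjointness of the inscribed
  discs and covering by the circumscribed ones. The two constants are so tight that rigidity
  follows.\<close>

definition hexagonal_packing :: "real \<Rightarrow> (real^2) set \<Rightarrow> bool" where
  "hexagonal_packing a C \<longleftrightarrow>
     (\<forall>c\<in>C. \<forall>d\<in>C. c \<noteq> d \<longrightarrow> sqrt 3 * a \<le> dist c d) \<and> (\<forall>x. \<exists>c\<in>C. dist x c \<le> a)"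

lemma hexagonal_packingD:
  assumes "hexagonal_packing a C"
  shows "\<And>c d. c \<in> C \<Longrightarrow> d \<in> C \<Longrightarrow> c \<noteq> d \<Longrightarrow> sqrt 3 * a \<le> dist c d"
    and "\<And>x. \<exists>c\<in>C. dist x c \<le> a"
  using assms unfolding hexagonal_packing_def by blast+

text \<open>Points near \<open>x\<close> outside the discs about \<open>F\<close> are covered from
  centers outside \<open>F\<close>, which are thus at distance less than
  \<open>a + \<epsilon>\<close> from \<open>x\<close>. As \<open>C - F\<close> is discrete and hence
  closed, a nearest one exists and attains the bound \<open>a\<close>.\<close>

lemma packing_another_center:
  assumes C: "hexagonal_packing a C" and "a > 0"
    and near: "\<And>\<epsilon>. \<epsilon> > 0 \<Longrightarrow> \<exists>y. dist x y < \<epsilon> \<and> (\<forall>c\<in>F. a < dist y c)"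
  obtains c where "c \<in> C" "c \<notin> F" "dist x c \<le> a"
proof -
  have *: "\<exists>c\<in>C - F. dist x c < \<epsilon> + a" if \<epsilon>: "\<epsilon> > 0" for \<epsilon>
  proof -
    obtain y where y: "dist x y < \<epsilon>" "\<forall>c\<in>F. a < dist y c" using near[OF \<epsilon>] by blast
    obtain c where c: "c \<in> C" "dist y c \<le> a" using hexagonal_packingD(2)[OF C] by blast
    then show ?thesis using y dist_triangle[of x c y] by force
  qed
  have "closed (C - F)"
  proof (rule discrete_imp_closed)
    show "0 < sqrt 3 * a" using \<open>a > 0\<close> by simp
    show "\<forall>x\<in>C - F. \<forall>y\<in>C - F. dist y x < sqrt 3 * a \<longrightarrow> y = x"
      using hexagonal_packingD(1)[OF C] by force
  qed
  moreover have "C - F \<noteq> {}" using *[of 1] by auto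
  ultimately obtain c where c: "c \<in> C - F" "\<And>d. d \<in> C - F \<Longrightarrow> dist x c \<le> dist x d"
    using distance_attains_inf[of "C - F" x] by blast
  have "dist x c \<le> a"
  proof (rule field_le_epsilon)
    fix \<epsilon> :: real assume "\<epsilon> > 0"
    then obtain d where "d \<in> C - F" "dist x d < \<epsilon> + a" using * by blast
    then show "dist x c \<le> a + \<epsilon>" using c(2)[of d] by linarith
  qed
  then show ?thesis using c(1) that by blast
qed

text \<open>The squared norm of the sum plus the squared differences equals three times the sum of
  squared norms; the hypotheses leave no slack in this identity.\<close>

lemma three_points_in_disc:
  fixes p q s :: "'a :: real_inner"
  assumes "a \<ge> 0" "norm p \<le> a" "norm q \<le> a" "norm s \<le> a"
    and "sqrt 3 * a \<le> norm (p - q)" "sqrt 3 * a \<le> norm (q - s)" "sqrt 3 * a \<le> norm (p - s)"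
  shows "p + q + s = 0" "(norm (p - q))\<^sup>2 = 3 * a\<^sup>2"
proof -
  have le: "(norm p)\<^sup>2 \<le> a\<^sup>2" "(norm q)\<^sup>2 \<le> a\<^sup>2" "(norm s)\<^sup>2 \<le> a\<^sup>2"
    using assms(2-4) by (auto intro: power_mono)
  have "(sqrt 3 * a)\<^sup>2 \<le> (norm (p - q))\<^sup>2" "(sqrt 3 * a)\<^sup>2 \<le> (norm (q - s))\<^sup>2" "(sqrt 3 * a)\<^sup>2 \<le> (norm (p - s))\<^sup>2"
    using assms by (auto intro!: power_mono)
  then have ge: "3 * a\<^sup>2 \<le> (norm (p - q))\<^sup>2" "3 * a\<^sup>2 \<le> (norm (q - s))\<^sup>2" "3 * a\<^sup>2 \<le> (norm (p - s))\<^sup>2"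
    by (simp_all add: power_mult_distrib)
  have eq: "(norm (p + q + s))\<^sup>2 + (norm (p - q))\<^sup>2 + (norm (q - s))\<^sup>2 + (norm (p - s))\<^sup>2
     = 3 * (norm p)\<^sup>2 + 3 * (norm q)\<^sup>2 + 3 * (norm s)\<^sup>2"
    by (simp add: power2_norm_eq_inner inner_add_left inner_add_right inner_diff_left inner_diff_right inner_commute)
  have nn: "0 \<le> (norm (p + q + s))\<^sup>2" by simp
  have "(norm (p + q + s))\<^sup>2 \<le> 0" using eq le ge by linarith
  then show "p + q + s = 0" by simp
  show "(norm (p - q))\<^sup>2 = 3 * a\<^sup>2"
  proof (rule antisym)
    show "(norm (p - q))\<^sup>2 \<le> 3 * a\<^sup>2" using eq le ge nn by linarith
  qed (rule ge)
qed

text \<open>Let \<open>x\<close> be one of the two points at distance \<open>a\<close> from both \<open>c\<close> and \<open>d\<close>. Arbitrarily close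
  to \<open>x\<close> there are points further than \<open>a\<close> from \<open>c\<close> and \<open>d\<close>, so a third center lies within \<open>a\<close>
  of \<open>x\<close>; three such centers form an equilateral triangle around \<open>x\<close>.\<close>
lemma packing_rot60:
  assumes C: "hexagonal_packing a C" and "a > 0"
    and c: "c \<in> C" "d \<in> C" "c \<noteq> d" "dist c d \<le> 2 * a"
  shows "dist c d = sqrt 3 * a" "c + rot60 (d - c) \<in> C"
proof -
  define g where "g = d - c"
  have g: "norm g > 0" "norm g \<le> 2 * a" "d = c + g"
    using c(3,4) by (auto simp: g_def dist_norm norm_minus_commute)
  define J where "J = quarter_turn g"
  have comb: "(norm (\<alpha> *\<^sub>R g + \<beta> *\<^sub>R J))\<^sup>2 = (\<alpha>\<^sup>2 + \<beta>\<^sup>2) * (norm g)\<^sup>2" for \<alpha> \<beta>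
    unfolding J_def power2_norm_eq_inner inner_real2 by (simp add: power2_eq_square algebra_simps)
  \<comment> \<open>Chosen so that \<open>c + (1/2) *\<^sub>R g + t *\<^sub>R J\<close> is at
    distance \<open>a\<close> from both centers. Taking the nonnegative root puts it on the
    counterclockwise side.\<close>
  define t where "t = sqrt (a\<^sup>2 / (norm g)\<^sup>2 - 1/4)"
  have "(norm g)\<^sup>2 \<le> (2 * a)\<^sup>2" using g by (intro power_mono) auto
  then have "0 \<le> a\<^sup>2 / (norm g)\<^sup>2 - 1/4" using g by (simp add: field_simps)
  then have t: "t \<ge> 0" "t\<^sup>2 = a\<^sup>2 / (norm g)\<^sup>2 - 1/4" by (simp_all add: t_def)
  then have tg: "(1/4 + t\<^sup>2) * (norm g)\<^sup>2 = a\<^sup>2" using g by simp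
  define y where "y \<epsilon> = c + (1/2) *\<^sub>R g + (t + \<epsilon>) *\<^sub>R J" for \<epsilon>
  have yc: "y \<epsilon> - c = (1/2) *\<^sub>R g + (t + \<epsilon>) *\<^sub>R J" for \<epsilon> by (simp add: y_def)
  have yd: "y \<epsilon> - d = (- (1/2)) *\<^sub>R g + (t + \<epsilon>) *\<^sub>R J" for \<epsilon>
    by (simp add: y_def g(3) vec2_eq_iff field_simps)
  have y2: "(dist (y \<epsilon>) c)\<^sup>2 = (1/4 + (t + \<epsilon>)\<^sup>2) * (norm g)\<^sup>2" "(dist (y \<epsilon>) d)\<^sup>2 = (1/4 + (t + \<epsilon>)\<^sup>2) * (norm g)\<^sup>2" for \<epsilon>
    unfolding dist_norm yc yd comb by (simp_all add: power_divide)
  define x where "x = y 0"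
  have x: "dist x c = a" "dist x d = a"
    using y2[of 0] tg \<open>a > 0\<close> by (auto simp: x_def intro: power2_eq_imp_eq)
  obtain c' where c': "c' \<in> C" "c' \<notin> {c, d}" "dist x c' \<le> a"
  proof (rule packing_another_center[OF C \<open>a > 0\<close>])
    fix \<epsilon> :: real assume \<epsilon>: "\<epsilon> > 0"
    \<comment> \<open>\<open>y \<delta>\<close> moves outward along the perpendicular bisector by
      half of \<epsilon>.\<close>
    define \<delta> where "\<delta> = \<epsilon> / (2 * norm g)"
    have \<delta>: "\<delta> > 0" using \<epsilon> g by (simp add: \<delta>_def)
    have J: "norm J = norm g" using comb[of 0 1] by simp
    have "dist x (y \<delta>) < \<epsilon>"
      using \<epsilon> g \<delta> by (simp add: x_def y_def dist_norm algebra_simps J) (simp add: \<delta>_def)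
    moreover have "a\<^sup>2 < (1/4 + (t + \<delta>)\<^sup>2) * (norm g)\<^sup>2"
    proof -
      have "t\<^sup>2 < (t + \<delta>)\<^sup>2" using t(1) \<delta> by (intro power_strict_mono) auto
      then show ?thesis unfolding tg[symmetric] using g by (intro mult_strict_right_mono) auto
    qed
    then have "a < dist (y \<delta>) c" "a < dist (y \<delta>) d"
      using y2[of \<delta>] by (auto intro: power2_less_imp_less)
    ultimately show "\<exists>y. dist x y < \<epsilon> \<and> (\<forall>c\<in>{c, d}. a < dist y c)" by blast
  qed blast
  have "c - x + (d - x) + (c' - x) = 0" and sq: "(norm (c - x - (d - x)))\<^sup>2 = 3 * a\<^sup>2"
    using three_points_in_disc[of a "c - x" "d - x" "c' - x"] x c' \<open>a > 0\<close> c
      hexagonal_packingD(1)[OF C]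
    by (auto simp: dist_norm norm_minus_commute)
  have "(dist c d)\<^sup>2 = (sqrt 3 * a)\<^sup>2" using sq by (simp add: dist_norm power_mult_distrib)
  then show d3: "dist c d = sqrt 3 * a" by (rule power2_eq_imp_eq) (use \<open>a > 0\<close> in auto)
  then have "(norm g)\<^sup>2 = 3 * a\<^sup>2" by (simp add: g_def dist_norm norm_minus_commute power_mult_distrib)
  then have "t\<^sup>2 = (sqrt 3 / 6)\<^sup>2" using t(2) \<open>a > 0\<close> by (simp add: power_divide)
  then have t6: "t = sqrt 3 / 6" by (rule power2_eq_imp_eq) (use t(1) in auto)
  \<comment> \<open>The three centers have centroid \<open>x\<close>, which determines the third
    from the other two.\<close>
  have "c' = 3 *\<^sub>R x - c - d"
    using \<open>c - x + (d - x) + (c' - x) = 0\<close> by (simp add: vec2_eq_iff)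
  then have "c' = c + rot60 g"
    unfolding x_def y_def t6 by (simp add: rot60_def J_def g(3) vec2_eq_iff field_simps)
  then show "c + rot60 (d - c) \<in> C" using c' by (simp add: g_def)
qed

lemma packing_star:
  assumes C: "hexagonal_packing a C" and "a > 0"
    and c: "c \<in> C" "c + v \<in> C" "norm v = sqrt 3 * a" and w: "w \<in> star v"
  shows "c + w \<in> C"
proof -
  have step: "c + rot60 u \<in> C \<and> norm (rot60 u) = sqrt 3 * a" if "c + u \<in> C \<and> norm u = sqrt 3 * a" for u
  proof -
    have "sqrt 3 \<le> 2" by (rule real_le_lsqrt) auto
    then have "dist c (c + u) \<le> 2 * a" using that \<open>a > 0\<close> by (simp add: dist_norm)
    moreover have "u \<noteq> 0" using that \<open>a > 0\<close> by auto
    ultimately show ?thesis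
      using packing_rot60(2)[OF C \<open>a > 0\<close> c(1), of "c + u"] that by simp
  qed
  have 0: "c + v \<in> C \<and> norm v = sqrt 3 * a" using c by simp
  note 1 = step[OF 0]
  note 2 = step[OF 1]
  note 3 = step[OF 2]
  note 4 = step[OF 3]
  note 5 = step[OF 4]
  show ?thesis using w 0 1 2 3 4 5 unfolding star_def by (auto simp: rot60_simps)
qed

text \<open>The induction carries the pair \<open>d\<close>, \<open>d + g\<close>: after a step
  \<open>v\<close>, the old center is a neighbor of the new one in direction \<open>- v\<close>, so
  all six neighbors of the new one are present, including the one in direction
  \<open>g\<close>.\<close>

lemma packing_translates:
  fixes n :: int
  assumes C: "hexagonal_packing a C" and "a > 0" and g: "norm g = sqrt 3 * a"
    and c: "c \<in> C" "c + g \<in> C" and w: "w \<in> star g"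
  shows "c + of_int n *\<^sub>R w \<in> C \<and> c + of_int n *\<^sub>R w + g \<in> C"
proof -
  have step: "d + v \<in> C \<and> d + v + g \<in> C" if d: "d \<in> C \<and> d + g \<in> C" and v: "v \<in> star g" for d v
  proof
    show dv: "d + v \<in> C" using packing_star[OF C \<open>a > 0\<close> _ _ g v] d by blast
    have "star (- v) = star g" using v star_eq star_minus by metis
    then have "g \<in> star (- v)" using star_self by blast
    moreover have "norm (- v) = sqrt 3 * a" using norm_star[OF v] g by simp
    ultimately show "d + v + g \<in> C" using packing_star[OF C \<open>a > 0\<close> dv, of "- v" g] d by simp
  qed
  show ?thesis
  proof (induction n rule: int_induct[where k = 0])
    case base then show ?case using c by simp
  next
    case (step1 i)
    then show ?case using step[OF step1(2) w] by (simp add: algebra_simps)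
  next
    case (step2 i)
    then show ?case using step[OF step2(2) star_uminus[OF w]] by (simp add: algebra_simps)
  qed
qed

lemma packing_is_lattice:
  assumes C: "hexagonal_packing a C" and "a > 0" and P: "P \<in> C"
  obtains e where "norm e = a" "C = hex_centers P e"
proof -
  \<comment> \<open>Any unit vector serves: probing the boundary of the disc about \<open>P\<close>
    produces a second center within \<open>2 * a\<close>.\<close>
  define b :: "real^2" where "b = vector [1, 0]"
  have b: "norm b = 1" by (simp add: b_def norm_eq_sqrt_inner inner_real2)
  obtain d where d: "d \<in> C" "d \<notin> {P}" "dist (P + a *\<^sub>R b) d \<le> a"
  proof (rule packing_another_center[OF C \<open>a > 0\<close>])
    fix \<epsilon> :: real assume "\<epsilon> > 0"
    then have "dist (P + a *\<^sub>R b) (P + (a + \<epsilon> / 2) *\<^sub>R b) < \<epsilon>"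
      by (simp add: dist_norm b flip: scaleR_diff_left)
    moreover have "a < dist (P + (a + \<epsilon> / 2) *\<^sub>R b) P"
      using \<open>\<epsilon> > 0\<close> \<open>a > 0\<close> by (simp add: dist_norm b)
    ultimately show "\<exists>y. dist (P + a *\<^sub>R b) y < \<epsilon> \<and> (\<forall>c\<in>{P}. a < dist y c)" by blast
  qed blast
  have "dist P (P + a *\<^sub>R b) = a" using \<open>a > 0\<close> by (simp add: dist_norm b)
  then have "dist P d \<le> 2 * a" using d(3) dist_triangle[of P d "P + a *\<^sub>R b"] by linarith
  then have Pd: "dist P d = sqrt 3 * a"
    using packing_rot60(1)[OF C \<open>a > 0\<close> P d(1)] d(2) by blast
  define g where "g = d - P"
  have g: "norm g = sqrt 3 * a" "P + g \<in> C"
    using Pd d(1) by (auto simp: g_def dist_norm norm_minus_commute)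
  \<comment> \<open>The solution of \<open>e + rot60 e = g\<close>: a shortest center difference is
    the sum of two adjacent vertex vectors.\<close>
  define e where "e = (1/3) *\<^sub>R (2 *\<^sub>R g + (-1) *\<^sub>R rot60 g)"
  have ge: "g = e + rot60 e" "rot60 g = 2 *\<^sub>R rot60 e - e"
    by (simp_all add: e_def rot60_simps vec2_eq_iff field_simps)
  have "(norm e)\<^sup>2 = (1/3)\<^sup>2 * ((2\<^sup>2 + 2 * (-1) + (-1)\<^sup>2) * (norm g)\<^sup>2)"
    unfolding e_def norm_scaleR power_mult_distrib norm_comb by simp
  then have "(norm e)\<^sup>2 = a\<^sup>2" by (simp add: g power_mult_distrib power_divide)
  then have e: "norm e = a" by (rule power2_eq_imp_eq) (use \<open>a > 0\<close> in auto)
  have sub: "hex_centers P e \<subseteq> C"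
  proof
    fix x assume "x \<in> hex_centers P e"
    then obtain m n :: int where x: "x = P + of_int m *\<^sub>R e + of_int n *\<^sub>R rot60 e" "3 dvd m - n"
      unfolding hex_centers_def by blast
    then obtain t where t: "n = m + 3 * t" by (metis add.commute diff_add_cancel dvdE dvd_diff_commute)
    have "rot60 g \<in> star g" by (simp add: star_def)
    then have "P + of_int (m + t) *\<^sub>R g + of_int t *\<^sub>R rot60 g \<in> C"
      using packing_translates[OF C \<open>a > 0\<close> g(1)] P g(2) star_self by blast
    moreover have "x = P + of_int (m + t) *\<^sub>R g + of_int t *\<^sub>R rot60 g"
      unfolding x t ge(2) by (simp add: ge(1) vec2_eq_iff algebra_simps)
    ultimately show "x \<in> C" by simp
  qed
  \<comment> \<open>The hexagons about the centers found so far already cover the plane, so a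
    further center would be within \<open>a\<close> of one of them, violating the
    separation.\<close>
  moreover have "C \<subseteq> hex_centers P e"
  proof
    fix c assume c: "c \<in> C"
    have "e \<noteq> 0" using e \<open>a > 0\<close> by auto
    then obtain c' where c': "c' \<in> hex_centers P e" "c \<in> hexagon c' e"
      by (rule hexagons_cover)
    then have "dist c c' \<le> a" using hexagon_subset_cball[of c' e] e by (auto simp: dist_commute)
    also have "a < sqrt 3 * a" using \<open>a > 0\<close> by simp
    finally have "c = c'" using hexagonal_packingD(1)[OF C c, of c'] c' sub by force
    then show "c \<in> hex_centers P e" using c' by simp
  qed
  ultimately show ?thesis using that e by blast
qed

text \<open>With \<open>g = d - c\<close>, the Voronoi inequality for the vertex
  \<open>c + e\<close> weighted by \<open>1 - \<epsilon>\<close> and the separation bound weighted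
  by \<epsilon> leave at least (1 + \<epsilon> + \<epsilon>^2) times the square of
  \<open>norm e\<close>.\<close>

lemma near_vertex_dist:
  assumes "c \<in> hex_centers P e" "d \<in> hex_centers P e" "c \<noteq> d" "0 < \<epsilon>" "\<epsilon> \<le> 1" "e \<noteq> 0"
  shows "norm e < dist (c + (1 - \<epsilon>) *\<^sub>R e) d"
proof (rule power2_less_imp_less)
  define g where "g = d - c"
  have "c + e \<in> hexagon c e" by (simp add: hexagon_vertex star_self)
  then have "dist (c + e) c \<le> dist (c + e) d"
    using hexagon_voronoi[OF assms(1,2)] by (auto simp: dist_le_iff_halfspace)
  then have "(norm e)\<^sup>2 \<le> (norm (e - g))\<^sup>2" by (auto simp: dist_norm g_def algebra_simps intro: power_mono)
  then have "2 * (e \<bullet> g) \<le> (norm g)\<^sup>2"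
    by (simp add: power2_norm_eq_inner inner_diff_left inner_diff_right inner_commute)
  then have 1: "(1 - \<epsilon>) * (2 * (e \<bullet> g)) \<le> (1 - \<epsilon>) * (norm g)\<^sup>2" using assms by (intro mult_left_mono) auto
  have "3 * (norm e)\<^sup>2 \<le> (norm g)\<^sup>2"
    using hex_centers_dist[OF assms(1-3)] by (simp add: g_def dist_norm norm_minus_commute)
  then have 2: "\<epsilon> * (3 * (norm e)\<^sup>2) \<le> \<epsilon> * (norm g)\<^sup>2" using assms by (intro mult_left_mono) auto
  have "0 < \<epsilon> * (norm e)\<^sup>2" "0 \<le> \<epsilon>\<^sup>2 * (norm e)\<^sup>2" using assms by auto
  then have 3: "(norm e)\<^sup>2 < (1 - \<epsilon>)\<^sup>2 * (norm e)\<^sup>2 + \<epsilon> * (3 * (norm e)\<^sup>2)"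
    by (simp add: power2_eq_square algebra_simps)
  have "c + (1 - \<epsilon>) *\<^sub>R e - d = (1 - \<epsilon>) *\<^sub>R e - g" by (simp add: g_def)
  then have "(dist (c + (1 - \<epsilon>) *\<^sub>R e) d)\<^sup>2 = (1 - \<epsilon>)\<^sup>2 * (norm e)\<^sup>2 - (1 - \<epsilon>) * (2 * (e \<bullet> g)) + (norm g)\<^sup>2"
    unfolding dist_norm
    by (simp only: power2_norm_eq_inner inner_diff_left inner_diff_right inner_commute inner_scaleR_left inner_scaleR_right)
       (simp add: power2_eq_square inner_commute)
  then show "(norm e)\<^sup>2 < (dist (c + (1 - \<epsilon>) *\<^sub>R e) d)\<^sup>2"
    using 1 2 3 by (simp add: algebra_simps)
qed simp

lemma tiling_centers_packing:
  assumes T: "hexagonal_tiling a T" and "a > 0"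
  shows "hexagonal_packing a {c. \<exists>K\<in>T. regular_hexagon a c K}"
  unfolding hexagonal_packing_def
proof (intro conjI ballI impI allI)
  fix c d assume "c \<in> {c. \<exists>K\<in>T. regular_hexagon a c K}" "d \<in> {c. \<exists>K\<in>T. regular_hexagon a c K}" and "c \<noteq> d"
  then obtain e f where e: "hexagon c e \<in> T" "norm e = a" and f: "hexagon d f \<in> T" "norm f = a"
    by (auto simp: regular_hexagon_iff[OF \<open>a > 0\<close>])
  \<comment> \<open>Distinct centers give distinct tiles, so the pairwise condition on interiors
    applies.\<close>
  have "hexagon c e \<noteq> hexagon d f" using hexagon_center_unique[of c e d f] e f \<open>c \<noteq> d\<close> by auto
  then have disj: "interior (hexagon c e) \<inter> interior (hexagon d f) = {}"
    using T e f unfolding hexagonal_tiling_def pairwise_def by blast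
  show "sqrt 3 * a \<le> dist c d"
  proof (rule ccontr)
    assume "\<not> sqrt 3 * a \<le> dist c d"
    then have "midpoint c d \<in> ball c (sqrt 3 / 2 * a)" "midpoint c d \<in> ball d (sqrt 3 / 2 * a)"
      by (auto simp: dist_midpoint)
    moreover have "ball c (sqrt 3 / 2 * a) \<subseteq> interior (hexagon c e)" "ball d (sqrt 3 / 2 * a) \<subseteq> interior (hexagon d f)"
      using e(2) f(2) by (intro ball_subset_interior_hexagon; simp)+
    ultimately show False using disj by blast
  qed
next
  fix x
  obtain K where "K \<in> T" "x \<in> K" using T unfolding hexagonal_tiling_def by blast
  moreover from this obtain c e where c: "norm e = a" "K = hexagon c e"
    using T regular_hexagon_iff[OF \<open>a > 0\<close>] unfolding hexagonal_tiling_def by blast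
  ultimately show "\<exists>c\<in>{c. \<exists>K\<in>T. regular_hexagon a c K}. dist x c \<le> a"
    using hexagon_subset_cball[of c e] regular_hexagon_iff[OF \<open>a > 0\<close>]
    by (intro bexI[of _ c]) (auto simp: dist_commute)
qed

text \<open>Points just inside a deep hole of the lattice of centers, on its segment to \<open>c\<close>, are further
  than \<open>a\<close> from all other centers, so only the hexagon about \<open>c\<close> can cover them. Hence this
  hexagon has a vertex at each adjacent deep hole, which fixes its orientation.\<close>
lemma tiling_eq_hexagons:
  assumes T: "hexagonal_tiling a T" and "a > 0" and K: "K \<in> T" "regular_hexagon a P K"
  obtains e where "norm e = a" "K = hexagon P e" "T = (\<lambda>c. hexagon c e) ` hex_centers P e"
proof -
  define C where "C = {c. \<exists>K\<in>T. regular_hexagon a c K}"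
  have "P \<in> C" using K by (auto simp: C_def)
  then obtain e where e: "norm e = a" "C = hex_centers P e"
    using packing_is_lattice[OF tiling_centers_packing[OF T \<open>a > 0\<close>] \<open>a > 0\<close>] unfolding C_def by blast
  have e0: "e \<noteq> 0" using e \<open>a > 0\<close> by auto
  have *: "L = hexagon c e" if L: "L \<in> T" "regular_hexagon a c L" for L c
  proof -
    obtain f where f: "norm f = a" "L = hexagon c f" using L regular_hexagon_iff[OF \<open>a > 0\<close>] by blast
    have cC: "c \<in> C" using L by (auto simp: C_def)
    have mem: "c + (1 - \<epsilon>) *\<^sub>R e \<in> L" if \<epsilon>: "0 < \<epsilon>" "\<epsilon> \<le> 1" for \<epsilon>
    proof -
      obtain M where M: "M \<in> T" "c + (1 - \<epsilon>) *\<^sub>R e \<in> M" using T unfolding hexagonal_tiling_def by blast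
      moreover from this obtain d h where d: "norm h = a" "M = hexagon d h"
        using T regular_hexagon_iff[OF \<open>a > 0\<close>] unfolding hexagonal_tiling_def by blast
      ultimately have "regular_hexagon a d M" using regular_hexagon_iff[OF \<open>a > 0\<close>] by blast
      then have "d \<in> C" using M unfolding C_def by blast
      have "dist (c + (1 - \<epsilon>) *\<^sub>R e) d \<le> norm e"
        using hexagon_subset_cball[of d h] M d e by (auto simp: dist_commute)
      with \<open>d \<in> C\<close> have "d = c" using near_vertex_dist[of c P e d \<epsilon>] cC \<epsilon> e0 e(2) by force
      \<comment> \<open>\<open>L\<close> and \<open>M\<close> share the center \<open>c\<close> but
        might differ by a rotation; the common inscribed disc rules this out.\<close>
      have "ball c (sqrt 3 / 2 * a) \<subseteq> interior L" "ball c (sqrt 3 / 2 * a) \<subseteq> interior M"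
        unfolding f(2) d(2) \<open>d = c\<close> using f(1) d(1) by (intro ball_subset_interior_hexagon; simp)+
      moreover have "c \<in> ball c (sqrt 3 / 2 * a)" using \<open>a > 0\<close> by simp
      ultimately have "L = M" using T L M unfolding hexagonal_tiling_def pairwise_def by blast
      then show ?thesis using M by simp
    qed
    \<comment> \<open>The vertex itself belongs to several standard hexagons, so it is reached only
      as a limit of points that \<open>L\<close> must cover.\<close>
    have "c + e \<in> closure L"
      unfolding closure_approachable
    proof (intro allI impI)
      fix \<epsilon> :: real assume \<epsilon>: "\<epsilon> > 0"
      define \<delta> where "\<delta> = min 1 (\<epsilon> / (2 * a))"
      have \<delta>: "0 < \<delta>" "\<delta> \<le> 1" "\<delta> * a < \<epsilon>"
      proof -
        have "\<delta> * a \<le> \<epsilon> / (2 * a) * a" unfolding \<delta>_def using \<open>a > 0\<close> by (intro mult_right_mono) auto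
        also have "\<dots> < \<epsilon>" using \<open>a > 0\<close> \<epsilon> by simp
        finally show "\<delta> * a < \<epsilon>" .
      qed (use \<epsilon> \<open>a > 0\<close> in \<open>auto simp: \<delta>_def\<close>)
      show "\<exists>y\<in>L. dist y (c + e) < \<epsilon>"
        using mem[OF \<delta>(1,2)] \<delta> e by (intro bexI[of _ "c + (1 - \<delta>) *\<^sub>R e"]) (auto simp: dist_norm algebra_simps)
    qed
    then have "c + e \<in> hexagon c f" using hexagon_closed[of c f] f(2) by simp
    then have "c + e - c \<in> star f" by (rule hexagon_dist_imp_vertex) (simp add: dist_norm e f)
    then show ?thesis using f(2) hexagon_eq[of e f c] by simp
  qed
  have "T = (\<lambda>c. hexagon c e) ` hex_centers P e"
  proof
    show "T \<subseteq> (\<lambda>c. hexagon c e) ` hex_centers P e"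
    proof
      fix L assume L: "L \<in> T"
      then obtain c where "regular_hexagon a c L" using T unfolding hexagonal_tiling_def by blast
      then show "L \<in> (\<lambda>c. hexagon c e) ` hex_centers P e"
        using *[OF L] L e(2) unfolding C_def by blast
    qed
    show "(\<lambda>c. hexagon c e) ` hex_centers P e \<subseteq> T"
      using * unfolding e(2)[symmetric] C_def by blast
  qed
  then show ?thesis using that e(1) *[OF K] by blast
qed

section \<open>The scaling\<close>

text \<open>Allows the generator to be a side vector of the given hexagon. One rotation is computed,
  the others iterate it, and the symmetry of \<open>v\<close> and \<open>e\<close> gives the reverse
  inclusion.\<close>

lemma hex_vertices_star:
  assumes "v \<in> star e" shows "hex_vertices P v = hex_vertices P e"
proof -
  have rot: "hex_vertices P (rot60 e) \<subseteq> hex_vertices P e" for e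
  proof
    fix x assume "x \<in> hex_vertices P (rot60 e)"
    then obtain m n :: int where x: "x = P + of_int m *\<^sub>R rot60 e + of_int n *\<^sub>R rot60 (rot60 e)" "\<not> 3 dvd m - n"
      unfolding hex_vertices_def by blast
    have "x = P + of_int (- n) *\<^sub>R e + of_int (m + n) *\<^sub>R rot60 e"
      by (simp add: x rot60_rot60 algebra_simps)
    moreover have "\<not> 3 dvd - n - (m + n)" using x(2) by presburger
    ultimately show "x \<in> hex_vertices P e" unfolding hex_vertices_def by blast
  qed
  have sub: "hex_vertices P v \<subseteq> hex_vertices P e" if "v \<in> star e" for v e
  proof -
    have 1: "hex_vertices P (rot60 e) \<subseteq> hex_vertices P e" by (rule rot)
    have 2: "hex_vertices P (rot60 e - e) \<subseteq> hex_vertices P e" using rot[of "rot60 e"] 1 by (simp add: rot60_simps)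
    have 3: "hex_vertices P (- e) \<subseteq> hex_vertices P e" using rot[of "rot60 e - e"] 2 by (simp add: rot60_simps)
    have 4: "hex_vertices P (- rot60 e) \<subseteq> hex_vertices P e" using rot[of "- e"] 3 by (simp add: rot60_simps)
    have 5: "hex_vertices P (e - rot60 e) \<subseteq> hex_vertices P e" using rot[of "- rot60 e"] 4 by (simp add: rot60_simps)
    have "v = e \<or> v = rot60 e \<or> v = rot60 e - e \<or> v = - e \<or> v = - rot60 e \<or> v = e - rot60 e"
      using that by (simp add: star_def)
    then show ?thesis using 1 2 3 4 5 by blast
  qed
  have "e \<in> star v" using assms star_eq star_self by blast
  then show ?thesis using sub[OF assms] sub[of e v] by blast
qed

text \<open>For non-adjacent vertices \<open>v\<close> and \<open>w\<close>, the midpoint of \<open>v\<close> and \<open>w\<close> also lies inside a long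
  diagonal with other endpoints, so \<open>closed_segment v w\<close> is no face.\<close>
lemma hexagon_edge:
  assumes edge: "closed_segment v w edge_of hexagon P e" and "e \<noteq> 0"
  shows "w - v \<in> star e"
proof -
  have face: "closed_segment v w face_of hexagon P e" and dim: "aff_dim (closed_segment v w) = 1"
    using edge by (auto simp: edge_of_def)
  have ext: "x extreme_point_of hexagon P e \<Longrightarrow> x \<in> closed_segment v w \<Longrightarrow> x = v \<or> x = w" for x
    using extreme_point_of_face[OF face, of x] by (simp add: extreme_point_of_segment)
  have "v extreme_point_of hexagon P e" "w extreme_point_of hexagon P e"
    using extreme_point_of_face[OF face, of v] extreme_point_of_face[OF face, of w]
    by (simp_all add: extreme_point_of_segment)
  define p q where "p = v - P" and "q = w - P"
  have p: "p \<in> star e" "q \<in> star e" "v = P + p" "w = P + q"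
    using \<open>v extreme_point_of hexagon P e\<close> \<open>w extreme_point_of hexagon P e\<close>
    by (simp_all add: p_def q_def extreme_hexagon_iff)
  have "v \<noteq> w" using dim by auto
  have star: "star p = star e" using p(1) by (rule star_eq)
  have norm0: "x \<noteq> 0" if "x \<in> star e" for x using norm_star[OF that] \<open>e \<noteq> 0\<close> by auto
  have no_diag: "z = p \<or> z = q" if z: "z \<in> star e" and s: "p + q = s *\<^sub>R z" "0 \<le> s" "s \<le> 1" for z s
  proof -
    have "P + (s / 2) *\<^sub>R z \<in> closed_segment v w"
    proof -
      have "P + (s / 2) *\<^sub>R z = midpoint v w"
        unfolding midpoint_def p(3,4) using s(1) by (simp add: vec2_eq_iff field_simps)
      then show ?thesis by simp
    qed
    moreover have "P + (s / 2) *\<^sub>R z \<in> open_segment (P + z) (P + - z)"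
      unfolding in_segment
    proof (intro conjI exI)
      show "P + z \<noteq> P + - z" using norm0[OF z] by (simp add: vec2_eq_iff)
      show "0 < 1/2 - s/4" "1/2 - s/4 < 1" using s by auto
      show "P + (s / 2) *\<^sub>R z = (1 - (1/2 - s/4)) *\<^sub>R (P + z) + (1/2 - s/4) *\<^sub>R (P + - z)"
        by (simp add: vec2_eq_iff field_simps)
    qed
    ultimately have "P + z \<in> closed_segment v w"
      using face_ofD[OF face] hexagon_vertex z star_uminus[OF z] by blast
    then have "P + z = v \<or> P + z = w"
      using ext vertex_extreme[OF z] by blast
    then show ?thesis using p by auto
  qed
  have pp: "p \<bullet> p > 0" using norm0[OF p(1)] by simp
  have "rot60 p \<in> star e" "p - rot60 p \<in> star e" using star by (auto simp: star_def[of p])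
  \<comment> \<open>These match the non-adjacent positions \<open>rot60 p - p\<close>,
    \<open>- p\<close> and \<open>- rot60 p\<close> of \<open>q\<close>: then \<open>p + q\<close>
    is \<open>rot60 p\<close>, zero and \<open>p - rot60 p\<close>.\<close>
  note nd = no_diag[OF this(1), of 1] no_diag[OF this(1), of 0] no_diag[OF this(2), of 1]
  \<comment> \<open>The inner product with \<open>p\<close> would force \<open>s = 1/2\<close>,
    while preservation of the norm forces the square of \<open>s\<close> to be 1.\<close>
  have ne: "rot60 p \<noteq> s *\<^sub>R p" for s
  proof
    assume *: "rot60 p = s *\<^sub>R p"
    have "p \<bullet> rot60 p = (p \<bullet> p) / 2" by (rule inner_rot60_self)
    then have "s = 1/2" using pp by (simp add: *)
    then have "s\<^sup>2 = (1/2)\<^sup>2" by (simp only:)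
    moreover have "s\<^sup>2 * (p \<bullet> p) = p \<bullet> p"
      using inner_rot60[of p p] by (simp add: * power2_eq_square)
    ultimately show False using pp by (simp add: power_divide)
  qed
  have ne1: "rot60 p \<noteq> p" "rot60 p \<noteq> - p" "rot60 p \<noteq> 0" "p \<noteq> 0"
    using ne[of 1] ne[of "-1"] ne[of 0] pp by auto
  have "q \<in> star p" using p(2) star by simp
  then consider "q = p" | "q = rot60 p" | "q = rot60 p - p" | "q = - p" | "q = - rot60 p" | "q = p - rot60 p"
    by (auto simp: star_def)
  then show ?thesis
  proof cases
    case 1 then show ?thesis using \<open>v \<noteq> w\<close> p by simp
  next
    case 2 then show ?thesis using star p(3,4) by (auto simp: star_def[of p])
  next
    case 3 then show ?thesis using nd(1) ne1 by simp
  next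
    case 4 then show ?thesis using nd(2) ne1 by simp
  next
    case 5 then show ?thesis using nd(3) ne1 by simp
  next
    case 6 then show ?thesis using star p(3,4) by (auto simp: star_def[of p])
  qed
qed

section \<open>The angle of 15 degrees and the image lattice\<close>

lemma cos_pi_12_squared: "(cos (pi / 12))\<^sup>2 = (2 + sqrt 3) / 4"
  using cos_double_cos[of "pi / 12"] cos_30 by simp

text \<open>With \<open>f = L e\<close>, where \<open>L\<close> is the linear part of the scaling, the rotated vector \<open>rot60 f\<close> is
  \<open>L (rot60 e \<plusminus> 3 e)\<close>. So the image lattice is spanned by \<open>f\<close> and \<open>rot60 f\<close>, and as the shear
  by \<open>\<plusminus> 3\<close> preserves \<open>m - n\<close> modulo 3, the hexagon centers correspond.\<close>
lemma scaling_hex_vertices: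
  assumes u: "norm u = 1" "\<bar>u \<bullet> e\<bar> = cos (pi / 12) * norm e" and "e \<noteq> 0"
  obtains f where "norm f = (2 - sqrt 3) * norm e"
    "directional_scaling u (7 - 4 * sqrt 3) P ` hex_vertices P e = hex_vertices P f"
proof -
  define N where "N = (norm e)\<^sup>2"
  define J where "J = quarter_turn e"
  define p q where "p = u \<bullet> e" and "q = u \<bullet> J"
  have N: "N > 0" "N = e $ 1 * e $ 1 + e $ 2 * e $ 2"
    using \<open>e \<noteq> 0\<close> by (simp_all add: N_def) (simp add: power2_norm_eq_inner inner_real2)
  have u1: "u $ 1 * u $ 1 + u $ 2 * u $ 2 = 1"
    using u(1) by (simp add: norm_eq_sqrt_inner inner_real2)
  have p2: "p\<^sup>2 = (2 + sqrt 3) / 4 * N"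
  proof -
    have "p\<^sup>2 = \<bar>u \<bullet> e\<bar>\<^sup>2" by (simp add: p_def)
    then show ?thesis unfolding u(2) power_mult_distrib cos_pi_12_squared N_def .
  qed
  have "p\<^sup>2 + q\<^sup>2 = (u $ 1 * u $ 1 + u $ 2 * u $ 2) * N"
    by (simp add: p_def q_def J_def N(2) inner_real2 power2_eq_square algebra_simps)
  then have q2: "q\<^sup>2 = (2 - sqrt 3) / 4 * N" using p2 u1 by (simp add: field_simps)
  \<comment> \<open>The angle fixes \<open>p * q\<close> up to sign; \<sigma> records on which side
    of the line of \<open>e\<close> the line of \<open>u\<close> lies.\<close>
  have "(p * q)\<^sup>2 = (N / 4)\<^sup>2"
    unfolding power_mult_distrib p2 q2 by (simp add: power2_eq_square field_simps)
  then obtain \<sigma> :: int where \<sigma>: "\<sigma> = 1 \<or> \<sigma> = - 1" "p * q = of_int \<sigma> * (N / 4)"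
    unfolding power2_eq_iff by (metis minus_mult_minus mult_1 mult_minus_left of_int_1 of_int_minus)
  have Nu: "N *\<^sub>R u = p *\<^sub>R e + q *\<^sub>R J"
    by (simp add: vec2_eq_iff p_def q_def J_def N(2) inner_real2 algebra_simps)
  \<comment> \<open>Only \<open>p *\<^sub>R u\<close> and \<open>q *\<^sub>R u\<close> enter the
    images of \<open>e\<close> and \<open>J\<close>, and these depend on the squares and the product
    of \<open>p\<close> and \<open>q\<close> alone.\<close>
  have pu: "p *\<^sub>R u = ((2 + sqrt 3) / 4) *\<^sub>R e + (of_int \<sigma> / 4) *\<^sub>R J"
  proof -
    have "N *\<^sub>R (p *\<^sub>R u) = p *\<^sub>R (N *\<^sub>R u)" by simp
    also have "\<dots> = p\<^sup>2 *\<^sub>R e + (p * q) *\<^sub>R J"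
      unfolding Nu by (simp add: power2_eq_square scaleR_right_distrib)
    also have "\<dots> = N *\<^sub>R (((2 + sqrt 3) / 4) *\<^sub>R e + (of_int \<sigma> / 4) *\<^sub>R J)"
      unfolding p2 \<sigma>(2) by (simp add: scaleR_right_distrib mult.commute)
    finally show ?thesis using N(1) by (metis less_irrefl scaleR_left_imp_eq)
  qed
  have qu: "q *\<^sub>R u = (of_int \<sigma> / 4) *\<^sub>R e + ((2 - sqrt 3) / 4) *\<^sub>R J"
  proof -
    have "N *\<^sub>R (q *\<^sub>R u) = q *\<^sub>R (N *\<^sub>R u)" by simp
    also have "\<dots> = (p * q) *\<^sub>R e + q\<^sup>2 *\<^sub>R J"
      unfolding Nu by (simp add: power2_eq_square scaleR_right_distrib mult.commute)
    also have "\<dots> = N *\<^sub>R ((of_int \<sigma> / 4) *\<^sub>R e + ((2 - sqrt 3) / 4) *\<^sub>R J)"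
      unfolding q2 \<sigma>(2) by (simp add: scaleR_right_distrib mult.commute)
    finally show ?thesis using N(1) by (metis less_irrefl scaleR_left_imp_eq)
  qed
  define L where "L x = x + ((6 - 4 * sqrt 3) * (x \<bullet> u)) *\<^sub>R u" for x
  have S: "directional_scaling u (7 - 4 * sqrt 3) P (P + x) = P + L x" for x
    by (simp add: directional_scaling_def L_def)
  have L_comb: "L (s *\<^sub>R x + t *\<^sub>R y) = s *\<^sub>R L x + t *\<^sub>R L y" for s t x y
    by (simp add: L_def inner_add_left algebra_simps)
  have s3: "sqrt 3 * sqrt 3 = 3" "sqrt 3 * (sqrt 3 * x) = 3 * x" for x :: real
    by (simp_all flip: mult.assoc)
  have Le: "L e = (1 - sqrt 3 / 2) *\<^sub>R e + (of_int \<sigma> * (3 / 2 - sqrt 3)) *\<^sub>R J"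
  proof -
    have "L e = e + (6 - 4 * sqrt 3) *\<^sub>R (p *\<^sub>R u)"
      by (simp add: L_def p_def inner_commute)
    then show ?thesis unfolding pu by (simp add: vec2_eq_iff field_simps s3)
  qed
  have LJ: "L J = (of_int \<sigma> * (3 / 2 - sqrt 3)) *\<^sub>R e + (7 - 7 / 2 * sqrt 3) *\<^sub>R J"
  proof -
    have "L J = J + (6 - 4 * sqrt 3) *\<^sub>R (q *\<^sub>R u)"
      by (simp add: L_def q_def inner_commute)
    then show ?thesis unfolding qu by (simp add: vec2_eq_iff field_simps s3)
  qed
  define f where "f = L e"
  have "3 *\<^sub>R (of_int \<sigma> *\<^sub>R e) + rot60 e = (3 * of_int \<sigma> + 1 / 2) *\<^sub>R e + (sqrt 3 / 2) *\<^sub>R J"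
    by (simp add: rot60_def J_def algebra_simps)
  then have "L (3 *\<^sub>R (of_int \<sigma> *\<^sub>R e) + rot60 e) = (3 * of_int \<sigma> + 1 / 2) *\<^sub>R L e + (sqrt 3 / 2) *\<^sub>R L J"
    by (simp only: L_comb)
  moreover have "rot60 f = (3 * of_int \<sigma> + 1 / 2) *\<^sub>R L e + (sqrt 3 / 2) *\<^sub>R L J"
    using \<sigma>(1) unfolding f_def Le LJ
    by (elim disjE) (simp_all add: J_def vec2_eq_iff rot60_nth field_simps s3)
  \<comment> \<open>\<open>e\<close> and \<open>3 * \<sigma>\<close> times \<open>e\<close> plus
    \<open>rot60 e\<close> form another basis of the same lattice, carried by \<open>L\<close> to
    \<open>f\<close> and \<open>rot60 f\<close>.\<close>
  ultimately have rot_f: "rot60 f = L ((3 * of_int \<sigma>) *\<^sub>R e + 1 *\<^sub>R rot60 e)" by simp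
  have comb: "of_int m *\<^sub>R f + of_int n *\<^sub>R rot60 f = L (of_int (m + 3 * \<sigma> * n) *\<^sub>R e + of_int n *\<^sub>R rot60 e)" for m n :: int
    unfolding rot_f L_comb unfolding f_def by (simp add: algebra_simps)
  \<comment> \<open>The value agrees with areas: the determinant of \<open>L\<close> is 7 - 4 sqrt
    3, the square of 2 - sqrt 3.\<close>
  have "(norm f)\<^sup>2 = ((2 - sqrt 3) * norm e)\<^sup>2"
  proof -
    have "(norm f)\<^sup>2 = ((1 - sqrt 3 / 2)\<^sup>2 + (of_int \<sigma> * (3 / 2 - sqrt 3))\<^sup>2) * N"
      unfolding f_def Le power2_norm_eq_inner inner_real2 N(2) by (simp add: J_def power2_eq_square algebra_simps s3)
    also have "\<dots> = (2 - sqrt 3)\<^sup>2 * N"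
      using \<sigma>(1) by (elim disjE) (simp_all add: power2_eq_square field_simps s3)
    finally show ?thesis by (simp add: N_def power_mult_distrib)
  qed
  moreover have "sqrt 3 \<le> 2" by (rule real_le_lsqrt) auto
  ultimately have norm_f: "norm f = (2 - sqrt 3) * norm e"
    by (intro power2_eq_imp_eq[of "norm f"]) auto
  have "directional_scaling u (7 - 4 * sqrt 3) P ` hex_vertices P e = hex_vertices P f"
  proof (intro equalityI subsetI)
    fix y assume "y \<in> directional_scaling u (7 - 4 * sqrt 3) P ` hex_vertices P e"
    then obtain m n :: int where y: "y = directional_scaling u (7 - 4 * sqrt 3) P (P + (of_int m *\<^sub>R e + of_int n *\<^sub>R rot60 e))"
      and mn: "\<not> 3 dvd m - n"
      unfolding hex_vertices_def by (auto simp: add.assoc)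
    have "y = P + of_int (m - 3 * \<sigma> * n) *\<^sub>R f + of_int n *\<^sub>R rot60 f"
      unfolding y S add.assoc comb by simp
    moreover have "\<not> 3 dvd (m - 3 * \<sigma> * n) - n"
      using mn \<sigma>(1) by (elim disjE) (simp, presburger)+
    ultimately show "y \<in> hex_vertices P f" unfolding hex_vertices_def by blast
  next
    fix y assume "y \<in> hex_vertices P f"
    then obtain m n :: int where y: "y = P + of_int m *\<^sub>R f + of_int n *\<^sub>R rot60 f" and mn: "\<not> 3 dvd m - n"
      unfolding hex_vertices_def by blast
    have "\<not> 3 dvd (m + 3 * \<sigma> * n) - n"
      using mn \<sigma>(1) by (elim disjE) (simp, presburger)+
    then have "P + of_int (m + 3 * \<sigma> * n) *\<^sub>R e + of_int n *\<^sub>R rot60 e \<in> hex_vertices P e"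
      unfolding hex_vertices_def by blast
    moreover have "y = directional_scaling u (7 - 4 * sqrt 3) P (P + of_int (m + 3 * \<sigma> * n) *\<^sub>R e + of_int n *\<^sub>R rot60 e)"
      unfolding y add.assoc comb S ..
    ultimately show "y \<in> directional_scaling u (7 - 4 * sqrt 3) P ` hex_vertices P e" by blast
  qed
  with norm_f that show thesis by blast
qed

text \<open>Cauchy-Schwarz puts the quotient in the range where \<open>cos\<close> inverts
  \<open>arccos\<close>; for a zero vector both sides vanish.\<close>

lemma abs_inner_eq_of_line_angle:
  assumes "line_angle u e = \<theta>" shows "\<bar>u \<bullet> e\<bar> = cos \<theta> * (norm u * norm e)"
proof (cases "norm u * norm e = 0")
  case False
  have "\<bar>u \<bullet> e\<bar> / (norm u * norm e) \<le> 1"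
    using False Cauchy_Schwarz_ineq2[of u e] by (simp add: divide_le_eq_1 zero_less_mult_iff)
  moreover have "0 \<le> \<bar>u \<bullet> e\<bar> / (norm u * norm e)" by simp
  ultimately have "cos \<theta> = \<bar>u \<bullet> e\<bar> / (norm u * norm e)"
    unfolding assms[symmetric] line_angle_def by (intro cos_arccos) linarith+
  then show ?thesis using False by simp
qed auto

theorem mainTheorem3:
  fixes H K :: "(real^2) set" and a :: real and P u v w :: "real^2"
  assumes "a > 0"
    and "honeycomb_lattice a H"
    and "unit_hexagon a H K" and "regular_hexagon a P K"
    and "closed_segment v w edge_of K"
    and "norm u = 1" and "line_angle u (w - v) = pi / 12"
  shows "honeycomb_lattice ((2 - sqrt 3) * a) (directional_scaling u (7 - 4 * sqrt 3) P ` H) \<and>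
         (\<exists>K'. unit_hexagon ((2 - sqrt 3) * a) (directional_scaling u (7 - 4 * sqrt 3) P ` H) K' \<and>
               regular_hexagon ((2 - sqrt 3) * a) P K')"
proof -
  obtain T where T: "hexagonal_tiling a T" "H = tiling_vertices T" "K \<in> T"
    using assms(3) unfolding unit_hexagon_def by blast
  obtain e where e: "norm e = a" "K = hexagon P e" "T = (\<lambda>c. hexagon c e) ` hex_centers P e"
    using tiling_eq_hexagons[OF T(1) \<open>a > 0\<close> T(3) assms(4)] by blast
  have "e \<noteq> 0" using e \<open>a > 0\<close> by auto
  then have d: "w - v \<in> star e" using hexagon_edge assms(5) e(2) by blast
  have norm_d: "norm (w - v) = a" using norm_star[OF d] e(1) by simp
  \<comment> \<open>The side vector against which the angle is measured becomes the generator of the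
    lattice.\<close>
  have H: "H = hex_vertices P (w - v)"
    unfolding T(2) e(3) hexagons_tiling_vertices hex_vertices_star[OF d] ..
  have "\<bar>u \<bullet> (w - v)\<bar> = cos (pi / 12) * norm (w - v)"
    using abs_inner_eq_of_line_angle[OF assms(7)] assms(6) by simp
  moreover have "w - v \<noteq> 0" using norm_d \<open>a > 0\<close> by auto
  ultimately obtain f where f: "norm f = (2 - sqrt 3) * norm (w - v)"
    "directional_scaling u (7 - 4 * sqrt 3) P ` H = hex_vertices P f"
    unfolding H using scaling_hex_vertices[OF assms(6)] by blast
  have "sqrt 3 < 2" by (rule real_less_lsqrt) auto
  then have b: "0 < (2 - sqrt 3) * a" using \<open>a > 0\<close> by simp
  have nf: "norm f = (2 - sqrt 3) * a" using f(1) norm_d by simp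
  let ?T' = "(\<lambda>c. hexagon c f) ` hex_centers P f"
  have "hexagonal_tiling ((2 - sqrt 3) * a) ?T'" using hexagons_tiling[of f P] b nf by simp
  moreover have "directional_scaling u (7 - 4 * sqrt 3) P ` H = tiling_vertices ?T'"
    unfolding f(2) hexagons_tiling_vertices ..
  moreover have "hexagon P f \<in> ?T'" using base_in_centers by blast
  moreover have "regular_hexagon ((2 - sqrt 3) * a) P (hexagon P f)"
    using regular_hexagon_iff[OF b] nf by blast
  ultimately show ?thesis unfolding honeycomb_lattice_def unit_hexagon_def by blast
qed

end
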